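(* For fixed positive integers $k,\ell$, as $m\to\infty$, $$\mathrm{forb}(m,\{Q_8,1_{k,\ell}\})=\mathrm{forb}(m,\{Q_8,0_{k,\ell}\})=\Theta(m).$$
   Context: A matrix is simple if it is a $(0,1)$-matrix with no repeated columns. $F\prec A$ means that some submatrix of $A$ is a row and column permutation of $F$. For a family $\mathcal F$ of $(0,1)$-matrices, $\mathrm{forb}(m,\mathcal F)$ is the maximum number of columns of an $m$-rowed simple matrix $A$ with $F\nprec A$ for all $F\in\mathcal F$. $1_{k,\ell}$ (resp. $0_{k,\ell}$) is the $k\times\ell$ matrix with all entries $1$ (resp. $0$), and $$Q_8=\begin{bmatrix}0&0&1&1\\1&0&1&0\\0&1&0&1\end{bmatrix}.$$
   Formalization: The Θ(m) claim is asserted for all positive k, l except k = l = 1, where it fails because forb(m,{Q_8,1_{1,1}}) = 1 for every m; the equality and the upper bound O(m) are still asserted there. *)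

theory Defs
  imports
    "Jordan_Normal_Form.DL_Submatrix"
    "HOL-Library.Landau_Symbols"
    "HOL-Combinatorics.Permutations"
begin

definition zero_one_mat :: "int mat \<Rightarrow> bool" where
  "zero_one_mat A \<longleftrightarrow> elements_mat A \<subseteq> {0, 1}"

definition simple_mat :: "int mat \<Rightarrow> bool" where
  "simple_mat A \<longleftrightarrow> zero_one_mat A \<and> distinct (cols A)"

definition row_col_perm :: "int mat \<Rightarrow> int mat \<Rightarrow> bool" where
  "row_col_perm F B \<longleftrightarrow>
     (\<exists>p q. p permutes {..<dim_row F} \<and> q permutes {..<dim_col F} \<and>
            B = mat (dim_row F) (dim_col F) (\<lambda>(i, j). F $$ (p i, q j)))"

definition configuration :: "int mat \<Rightarrow> int mat \<Rightarrow> bool" (infix "\<prec>" 50) where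
  "F \<prec> A \<longleftrightarrow> (\<exists>I J. row_col_perm F (submatrix A I J))"

text \<open>An \<open>m\<close>-rowed simple matrix has at most \<open>2 ^ m\<close> columns, so the set below is finite. It
  contains \<open>0\<close>, witnessed by the matrix without columns, as soon as every member of the family
  has a column.\<close>

definition forb :: "nat \<Rightarrow> int mat set \<Rightarrow> nat" where
  "forb m \<F> = Max {dim_col A | A. dim_row A = m \<and> simple_mat A \<and> (\<forall>F\<in>\<F>. \<not> F \<prec> A)}"

definition ones_mat :: "nat \<Rightarrow> nat \<Rightarrow> int mat" where
  "ones_mat k l = mat k l (\<lambda>_. 1)"

definition Q8 :: "int mat" where
  "Q8 = mat_of_rows_list 4
     [[0, 0, 1, 1],
      [1, 0, 1, 0],
      [0, 1, 0, 1]]"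

end

theory Submission
  imports Defs
begin

text \<open>Delete a row \<open>r\<close>: the number of columns drops by the number of columns of the remaining rows
  that occur both with \<open>0\<close> and with \<open>1\<close> in row \<open>r\<close>. Since \<open>Q8\<close> is the product of the row \<open>[0 1]\<close> with
  the identity matrix of order 2, those repeated columns form a chain of sets; in a chain, avoiding
  the all-ones matrix leaves at most \<open>k\<close> sets of size below \<open>k\<close> and fewer than \<open>l\<close> others. So each
  row contributes at most \<open>k + l\<close> columns. Complementation fixes \<open>Q8\<close> up to a permutation and
  exchanges the two constant matrices, and identity matrices give the lower bound.\<close>

section \<open>Set families\<close>

text \<open>The traces on \<open>a\<close>, \<open>b\<close>, \<open>c\<close> are the columns of
  \<open>Q8\<close> from left to right. They are pairwise different, so \<open>S\<close>,
  \<open>T\<close>, \<open>U\<close>, \<open>V\<close> are automatically distinct.\<close>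

definition Q8_free :: "'a set set \<Rightarrow> bool" where
  "Q8_free F \<longleftrightarrow> \<not> (\<exists>a b c. \<exists>S\<in>F. \<exists>T\<in>F. \<exists>U\<in>F. \<exists>V\<in>F. distinct [a, b, c] \<and>
     S \<inter> {a, b, c} = {b} \<and> T \<inter> {a, b, c} = {c} \<and> U \<inter> {a, b, c} = {a, b} \<and> V \<inter> {a, b, c} = {a, c})"

text \<open>\<open>K\<close> ranges over the whole type, so no ground set has to be carried along; a
  \<open>K\<close> inside no member only demands \<open>0 < l\<close>.\<close>

definition ones_free :: "nat \<Rightarrow> nat \<Rightarrow> 'a set set \<Rightarrow> bool" where
  "ones_free k l F \<longleftrightarrow> (\<forall>K. finite K \<and> card K = k \<longrightarrow> card {S \<in> F. K \<subseteq> S} < l)"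

lemma Q8_freeD:
  assumes "Q8_free F" "S \<in> F" "T \<in> F" "U \<in> F" "V \<in> F" "distinct [a, b, c]"
    and "S \<inter> {a, b, c} = {b}" "T \<inter> {a, b, c} = {c}" "U \<inter> {a, b, c} = {a, b}" "V \<inter> {a, b, c} = {a, c}"
  shows False
proof -
  have "\<exists>a b c. \<exists>S\<in>F. \<exists>T\<in>F. \<exists>U\<in>F. \<exists>V\<in>F. distinct [a, b, c] \<and>
     S \<inter> {a, b, c} = {b} \<and> T \<inter> {a, b, c} = {c} \<and> U \<inter> {a, b, c} = {a, b} \<and> V \<inter> {a, b, c} = {a, c}"
    using assms(2-) by (intro exI bexI[of _ S] bexI[of _ T] bexI[of _ U] bexI[of _ V] conjI)
  with assms(1) show False unfolding Q8_free_def by contradiction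
qed

text \<open>Nested finite sets of equal size coincide, so each size below \<open>k\<close> occurs at
  most once. The members of size at least \<open>k\<close> all contain the smallest of them, hence
  share one \<open>k\<close>-subset.\<close>

lemma chain_card_le:
  assumes fin: "finite H" "\<And>S. S \<in> H \<Longrightarrow> finite S"
    and chain: "\<And>S T. S \<in> H \<Longrightarrow> T \<in> H \<Longrightarrow> S \<subseteq> T \<or> T \<subseteq> S"
    and ones: "ones_free k l H"
  shows "card H \<le> k + l"
proof -
  have "inj_on card {S \<in> H. card S < k}"
  proof (rule inj_onI)
    fix S T assume "S \<in> {S \<in> H. card S < k}" "T \<in> {S \<in> H. card S < k}" "card S = card T"
    then show "S = T" using chain[of S T] fin(2) by (metis (no_types, lifting) card_subset_eq mem_Collect_eq)
  qed
  then have small: "card {S \<in> H. card S < k} \<le> k"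
    using card_inj_on_le[of card _ "{..<k}"] by auto
  have large: "card {S \<in> H. k \<le> card S} \<le> l"
  proof (cases "{S \<in> H. k \<le> card S} = {}")
    case False
    obtain S where S: "S \<in> H" "k \<le> card S" and min: "\<And>T. T \<in> H \<Longrightarrow> k \<le> card T \<Longrightarrow> card S \<le> card T"
      using False ex_min_if_finite[of "card ` {S \<in> H. k \<le> card S}"] fin(1)
      by (auto simp: not_less)
    obtain K where K: "K \<subseteq> S" "card K = k" "finite K"
      using obtain_subset_with_card_n[OF S(2)] by blast
    \<comment> \<open>If instead \<open>T \<subseteq> S\<close>, minimality of \<open>card S\<close>
      forces \<open>T = S\<close>.\<close>
    have "K \<subseteq> T" if "T \<in> H" "k \<le> card T" for T
      using chain[OF S(1) that(1)] min[OF that] card_seteq[of S T] fin(2) S(1) K(1) by blast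
    then have "{S \<in> H. k \<le> card S} \<subseteq> {S \<in> H. K \<subseteq> S}" by blast
    then have "card {S \<in> H. k \<le> card S} \<le> card {S \<in> H. K \<subseteq> S}"
      using fin(1) by (intro card_mono) auto
    then show ?thesis using ones K unfolding ones_free_def by fastforce
  qed (simp only: card.empty)
  have "H = {S \<in> H. card S < k} \<union> {S \<in> H. k \<le> card S}" by auto
  then have "card H \<le> card {S \<in> H. card S < k} + card {S \<in> H. k \<le> card S}"
    by (metis card_Un_le)
  with small large show ?thesis by linarith
qed

text \<open>Incomparable \<open>S\<close> and \<open>T\<close> give \<open>b\<close> in
  \<open>S\<close> only and \<open>c\<close> in \<open>T\<close> only; with \<open>r\<close> as top
  row, \<open>S\<close>, \<open>T\<close>, \<open>insert r S\<close>, \<open>insert r T\<close> show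
  the columns of \<open>Q8\<close> in order.\<close>

lemma Q8_free_repeated_chain:
  assumes "Q8_free F" "S \<in> F" "insert r S \<in> F" "T \<in> F" "insert r T \<in> F" "r \<notin> S" "r \<notin> T"
  shows "S \<subseteq> T \<or> T \<subseteq> S"
proof (rule ccontr)
  assume "\<not> ?thesis"
  then obtain b c where bc: "b \<in> S" "b \<notin> T" "c \<in> T" "c \<notin> S" by blast
  show False
  proof (rule Q8_freeD)
    show "distinct [r, b, c]" using bc assms(6,7) by auto
    show "S \<inter> {r, b, c} = {b}" "T \<inter> {r, b, c} = {c}"
      "insert r S \<inter> {r, b, c} = {r, b}" "insert r T \<inter> {r, b, c} = {r, c}"
      using bc assms(6,7) by auto
  qed (fact assms)+
qed

lemma Q8_free_delete:
  assumes "Q8_free F"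
  shows "Q8_free ((\<lambda>S. S - {r}) ` F)"
  unfolding Q8_free_def
proof clarsimp
  fix a b c S T U V
  assume F: "S \<in> F" "T \<in> F" "U \<in> F" "V \<in> F" and d: "a \<noteq> b" "a \<noteq> c" "b \<noteq> c"
    and eq: "(S - {r}) \<inter> {a, b, c} = {b}" "(T - {r}) \<inter> {a, b, c} = {c}"
    "(U - {r}) \<inter> {a, b, c} = {a, b}" "(V - {r}) \<inter> {a, b, c} = {a, c}"
  \<comment> \<open>Each of the three points lies in some reduced set, so none is \<open>r\<close>,
    and the original sets have the same traces.\<close>
  have "r \<notin> {a, b, c}" using eq by blast
  then have "S \<inter> {a, b, c} = {b}" "T \<inter> {a, b, c} = {c}" "U \<inter> {a, b, c} = {a, b}" "V \<inter> {a, b, c} = {a, c}"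
    using eq by blast+
  moreover have "distinct [a, b, c]" using d by simp
  ultimately show False using assms F by (intro Q8_freeD)
qed

lemma ones_free_subset:
  fixes F :: "'a set set"
  assumes "finite F" "ones_free k l F" "H \<subseteq> F"
  shows "ones_free k l H"
  unfolding ones_free_def
proof (intro allI impI)
  fix K :: "'a set" assume K: "finite K \<and> card K = k"
  have "card {S \<in> H. K \<subseteq> S} \<le> card {S \<in> F. K \<subseteq> S}"
    using assms(1,3) by (intro card_mono) auto
  also have "\<dots> < l"
    using assms(2) K unfolding ones_free_def by blast
  finally show "card {S \<in> H. K \<subseteq> S} < l" .
qed

text \<open>A reduced set containing \<open>K\<close> comes from a member containing
  \<open>K\<close>, and merging members only lowers the count.\<close>

lemma ones_free_delete:
  fixes F :: "'a set set"
  assumes "finite F" "ones_free k l F"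
  shows "ones_free k l ((\<lambda>S. S - {r}) ` F)"
  unfolding ones_free_def
proof (intro allI impI)
  fix K :: "'a set" assume K: "finite K \<and> card K = k"
  have "{S \<in> (\<lambda>S. S - {r}) ` F. K \<subseteq> S} \<subseteq> (\<lambda>S. S - {r}) ` {S \<in> F. K \<subseteq> S}" by blast
  then have "card {S \<in> (\<lambda>S. S - {r}) ` F. K \<subseteq> S} \<le> card {S \<in> F. K \<subseteq> S}"
    using assms(1) surj_card_le[of "{S \<in> F. K \<subseteq> S}"] by simp
  also have "card {S \<in> F. K \<subseteq> S} < l"
    using assms(2) K unfolding ones_free_def by blast
  finally show "card {S \<in> (\<lambda>S. S - {r}) ` F. K \<subseteq> S} < l" .
qed

text \<open>Deletion identifies only pairs \<open>S\<close>, \<open>insert r S\<close>; dropping the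
  \<open>r\<close>-free partner of each pair makes it injective.\<close>

lemma card_delete:
  assumes "finite F"
  shows "card F \<le> card ((\<lambda>S. S - {r}) ` F) + card {S \<in> F. r \<notin> S \<and> insert r S \<in> F}"
proof -
  let ?d = "\<lambda>S. S - {r}" and ?H = "{S \<in> F. r \<notin> S \<and> insert r S \<in> F}"
  have "inj_on ?d (F - ?H)"
  proof (rule inj_onI, rule ccontr)
    fix S T assume "S \<in> F - ?H" "T \<in> F - ?H" "S - {r} = T - {r}" "S \<noteq> T"
    moreover from this have "S = insert r T \<and> r \<notin> T \<or> T = insert r S \<and> r \<notin> S" by blast
    ultimately show False by auto
  qed
  then have "card (F - ?H) \<le> card (?d ` F)"
    using assms by (intro card_inj_on_le[of ?d]) auto
  moreover have "card F = card (F - ?H) + card ?H"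
    using assms card_Diff_subset[of ?H F] card_mono[of F ?H] by (simp add: finite_subset[of ?H F])
  ultimately show ?thesis by linarith
qed

text \<open>Each point of the ground set accounts for at most \<open>k + l\<close> members by the
  chain bound; the summand 1 comes from the empty ground set, where \<open>F\<close> holds at most
  the empty set.\<close>

lemma Q8_ones_free_card_le:
  assumes "finite X" "F \<subseteq> Pow X" "Q8_free F" "ones_free k l F" "l \<ge> 1"
  shows "card F \<le> 1 + card X * (k + l)"
  using assms(1-4)
proof (induction X arbitrary: F rule: finite_induct)
  case empty
  then show ?case using card_mono[of "{{}}" F] by auto
next
  case (insert r X)
  let ?G = "(\<lambda>S. S - {r}) ` F" and ?H = "{S \<in> F. r \<notin> S \<and> insert r S \<in> F}"
  have fin: "finite F" using insert.hyps(1) insert.prems(1) by (meson finite.insertI finite_Pow_iff finite_subset)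
  have "card ?G \<le> 1 + card X * (k + l)"
    using insert.prems fin assms(5) by (intro insert.IH Q8_free_delete ones_free_delete) auto
  moreover have "card ?H \<le> k + l"
  proof (rule chain_card_le)
    show "finite ?H" using fin by simp
    show "finite S" if "S \<in> ?H" for S
      using that insert.prems(1) insert.hyps(1) finite_subset[of S "insert r X"] by auto
    show "S \<subseteq> T \<or> T \<subseteq> S" if "S \<in> ?H" "T \<in> ?H" for S T
      using that Q8_free_repeated_chain[OF insert.prems(2), of S r T] by simp
    show "ones_free k l ?H"
      using fin insert.prems(3) by (rule ones_free_subset) auto
  qed
  ultimately show ?case using card_delete[OF fin, of r] insert.hyps by simp
qed

section \<open>Configurations\<close>

lemma bij_betw_pick: "finite I \<Longrightarrow> bij_betw (pick I) {..<card I} I"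
  unfolding bij_betw_def
proof
  assume fin: "finite I"
  show inj: "inj_on (pick I) {..<card I}"
    by (rule inj_onI) (metis card_pick_le lessThan_iff)
  have "pick I ` {..<card I} \<subseteq> I" using pick_in_set_le by auto
  then show "pick I ` {..<card I} = I"
    using card_seteq[OF fin] by (simp add: card_image[OF inj])
qed

text \<open>\<open>submatrix\<close> lists its indices increasingly through \<open>pick\<close>. An
  arbitrary enumeration \<open>f\<close> of \<open>I\<close> differs from that order by the
  permutation \<open>inv_into {..<n} f \<circ> pick I\<close>.\<close>

lemma permutes_of_bij_betw:
  assumes "bij_betw f {..<n} I" "finite I"
  obtains p where "p permutes {..<n}" "card I = n" "\<And>i. i < n \<Longrightarrow> f (p i) = pick I i"
proof -
  have card: "card I = n" using bij_betw_same_card[OF assms(1)] by simp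
  define p where "p = (\<lambda>i. if i \<in> {..<n} then inv_into {..<n} f (pick I i) else i)"
  have pick: "bij_betw (pick I) {..<n} I" using bij_betw_pick[OF assms(2)] card by simp
  have "bij_betw (inv_into {..<n} f \<circ> pick I) {..<n} {..<n}"
    using bij_betw_trans[OF pick bij_betw_inv_into[OF assms(1)]] .
  then have "bij_betw p {..<n} {..<n}"
    by (rule bij_betw_cong[THEN iffD1, rotated]) (simp add: p_def)
  then have "p permutes {..<n}" by (rule bij_imp_permutes) (simp add: p_def)
  moreover have "f (p i) = pick I i" if "i < n" for i
    using that pick assms(1) by (auto simp: p_def bij_betw_def intro!: f_inv_into_f)
  ultimately show ?thesis using that card by blast
qed

text \<open>Together with \<open>configurationI\<close> this replaces index sets and permutations by
  injective selections of rows and columns, the form used from here on.\<close>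

lemma configurationE:
  assumes "F \<prec> A"
  obtains f g where "inj_on f {..<dim_row F}" "f ` {..<dim_row F} \<subseteq> {..<dim_row A}"
    "inj_on g {..<dim_col F}" "g ` {..<dim_col F} \<subseteq> {..<dim_col A}"
    "\<And>i j. i < dim_row F \<Longrightarrow> j < dim_col F \<Longrightarrow> A $$ (f i, g j) = F $$ (i, j)"
proof -
  from assms obtain I J p q where p: "p permutes {..<dim_row F}" and q: "q permutes {..<dim_col F}"
    and eq: "submatrix A I J = mat (dim_row F) (dim_col F) (\<lambda>(i, j). F $$ (p i, q j))"
    unfolding configuration_def row_col_perm_def by auto
  have dims: "dim_row F = card {i. i < dim_row A \<and> i \<in> I}" "dim_col F = card {j. j < dim_col A \<and> j \<in> J}"
    using eq dim_submatrix[of A I J] by simp_all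
  \<comment> \<open>Position \<open>i\<close> of the submatrix corresponds to index
    \<open>p i\<close> of \<open>F\<close>, hence the inverse of \<open>p\<close>. The claim serves
    both rows and columns.\<close>
  have emb: "inj_on (pick I \<circ> inv_into UNIV p) {..<n}" "(pick I \<circ> inv_into UNIV p) ` {..<n} \<subseteq> {..<d}"
    if n: "n = card {i. i < d \<and> i \<in> I}" and p: "p permutes {..<n}" for n d I p
  proof -
    have "inj_on (pick I) {..<n}"
    proof (rule strict_mono_on_imp_inj_on, rule strict_mono_onI)
      fix r s assume "s \<in> {..<n}" and less: "r < s"
      \<comment> \<open>\<open>I\<close> may be infinite or reach beyond the matrix;
        \<open>pick\<close> increases strictly below \<open>card I\<close>, or everywhere if
        \<open>I\<close> is infinite.\<close>
      then have "s < card I \<or> infinite I"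
        using n card_mono[of I "{i. i < d \<and> i \<in> I}"] by fastforce
      then show "pick I r < pick I s" using pick_mono less by blast
    qed
    then show "inj_on (pick I \<circ> inv_into UNIV p) {..<n}"
      using permutes_inv[OF p] by (intro comp_inj_on) (auto simp: permutes_image permutes_inj_on)
    show "(pick I \<circ> inv_into UNIV p) ` {..<n} \<subseteq> {..<d}"
      using permutes_in_image[OF permutes_inv[OF p]] pick_le n by fastforce
  qed
  have "A $$ ((pick I \<circ> inv_into UNIV p) i, (pick J \<circ> inv_into UNIV q) j) = F $$ (i, j)"
    if ij: "i < dim_row F" "j < dim_col F" for i j
  proof -
    have lt: "inv_into UNIV p i < dim_row F" "inv_into UNIV q j < dim_col F"
      using ij permutes_in_image[OF permutes_inv[OF p]] permutes_in_image[OF permutes_inv[OF q]] by simp_all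
    then have "A $$ (pick I (inv_into UNIV p i), pick J (inv_into UNIV q j)) = submatrix A I J $$ (inv_into UNIV p i, inv_into UNIV q j)"
      using dims by (simp add: submatrix_index)
    also have "\<dots> = F $$ (i, j)"
      using eq lt permutes_inverses[OF p] permutes_inverses[OF q] by simp
    finally show ?thesis by simp
  qed
  then show ?thesis using emb[OF dims(1) p] emb[OF dims(2) q] by (rule that[rotated 4])
qed

text \<open>The images of \<open>f\<close> and \<open>g\<close> serve as index sets;
  \<open>permutes_of_bij_betw\<close> absorbs the order in which they are enumerated.\<close>

lemma configurationI:
  assumes f: "inj_on f {..<dim_row F}" "f ` {..<dim_row F} \<subseteq> {..<dim_row A}"
    and g: "inj_on g {..<dim_col F}" "g ` {..<dim_col F} \<subseteq> {..<dim_col A}"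
    and eq: "\<And>i j. i < dim_row F \<Longrightarrow> j < dim_col F \<Longrightarrow> A $$ (f i, g j) = F $$ (i, j)"
  shows "F \<prec> A"
proof -
  define I J where "I = f ` {..<dim_row F}" and "J = g ` {..<dim_col F}"
  obtain p where p: "p permutes {..<dim_row F}" "card I = dim_row F"
      "\<And>i. i < dim_row F \<Longrightarrow> f (p i) = pick I i"
    using permutes_of_bij_betw[of f "dim_row F" I] f(1) by (auto simp: I_def bij_betw_def)
  obtain q where q: "q permutes {..<dim_col F}" "card J = dim_col F"
      "\<And>j. j < dim_col F \<Longrightarrow> g (q j) = pick J j"
    using permutes_of_bij_betw[of g "dim_col F" J] g(1) by (auto simp: J_def bij_betw_def)
  have "{i. i < dim_row A \<and> i \<in> I} = I" "{j. j < dim_col A \<and> j \<in> J} = J"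
    using f(2) g(2) by (auto simp: I_def J_def)
  then have "submatrix A I J = mat (dim_row F) (dim_col F) (\<lambda>(i, j). A $$ (pick I i, pick J j))"
    by (simp add: submatrix_def p(2) q(2))
  also have "\<dots> = mat (dim_row F) (dim_col F) (\<lambda>(i, j). F $$ (p i, q j))"
    using permutes_in_image[OF p(1)] permutes_in_image[OF q(1)]
    by (intro cong_mat) (auto simp: p(3)[symmetric] q(3)[symmetric] eq)
  finally show "F \<prec> A" using p(1) q(1) unfolding configuration_def row_col_perm_def by blast
qed

section \<open>Dimensions and entries of the forbidden matrices\<close>

lemma dim_ones_mat [simp]: "dim_row (ones_mat k l) = k" "dim_col (ones_mat k l) = l"
  by (simp_all add: ones_mat_def)

lemma ones_mat_index [simp]: "i < k \<Longrightarrow> j < l \<Longrightarrow> ones_mat k l $$ (i, j) = 1"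
  by (simp add: ones_mat_def)

lemma dim_Q8 [simp]: "dim_row Q8 = 3" "dim_col Q8 = 4"
  by (simp_all add: Q8_def mat_of_rows_list_def)

lemma Q8_index:
  "Q8 $$ (0, 0) = 0" "Q8 $$ (0, 1) = 0" "Q8 $$ (0, 2) = 1" "Q8 $$ (0, 3) = 1"
  "Q8 $$ (1, 0) = 1" "Q8 $$ (1, 1) = 0" "Q8 $$ (1, 2) = 1" "Q8 $$ (1, 3) = 0"
  "Q8 $$ (2, 0) = 0" "Q8 $$ (2, 1) = 1" "Q8 $$ (2, 2) = 0" "Q8 $$ (2, 3) = 1"
  by (simp_all add: Q8_def mat_of_rows_list_def)

lemma all_less_numeral_3: "(\<forall>i<3. P i) \<longleftrightarrow> P (0::nat) \<and> P 1 \<and> P 2"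
  by (auto simp: numeral_3_eq_3 less_Suc_eq numeral_2_eq_2)

lemma all_less_numeral_4: "(\<forall>i<4. P i) \<longleftrightarrow> P (0::nat) \<and> P 1 \<and> P 2 \<and> P 3"
  by (auto simp: eval_nat_numeral less_Suc_eq)

section \<open>Matrices as set families\<close>

text \<open>The bound on \<open>i\<close> matters: entries outside the matrix are unspecified and
  must not enter the set.\<close>

definition supp :: "int mat \<Rightarrow> nat \<Rightarrow> nat set" where
  "supp A j = {i. i < dim_row A \<and> A $$ (i, j) = 1}"

lemma zero_one_mat_entry:
  assumes "zero_one_mat A" "i < dim_row A" "j < dim_col A"
  shows "A $$ (i, j) = 0 \<or> A $$ (i, j) = 1"
  using assms elements_matI[of A "dim_row A" "dim_col A" i j] unfolding zero_one_mat_def by auto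

text \<open>A (0,1)-column is determined by its support, so the columns of a simple matrix can be
  counted as sets.\<close>

lemma simple_mat_iff:
  "simple_mat A \<longleftrightarrow> zero_one_mat A \<and> inj_on (supp A) {..<dim_col A}"
proof -
  have eq: "supp A j = supp A j' \<longleftrightarrow> col A j = col A j'"
    if "zero_one_mat A" "j < dim_col A" "j' < dim_col A" for j j'
  proof
    assume eq: "supp A j = supp A j'"
    show "col A j = col A j'"
    proof (rule eq_vecI)
      fix i assume "i < dim_vec (col A j')"
      then have i: "i < dim_row A" by simp
      then have "A $$ (i, j) = 1 \<longleftrightarrow> A $$ (i, j') = 1" using eq unfolding supp_def by blast
      then show "col A j $ i = col A j' $ i"
        using that i zero_one_mat_entry[OF that(1) i, of j] zero_one_mat_entry[OF that(1) i, of j'] by auto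
    qed simp
  next
    assume "col A j = col A j'"
    then have "A $$ (i, j) = A $$ (i, j')" if "i < dim_row A" for i
      using that \<open>j < dim_col A\<close> \<open>j' < dim_col A\<close> by (metis index_col)
    then show "supp A j = supp A j'" by (auto simp: supp_def)
  qed
  have "inj_on (supp A) {..<dim_col A} \<longleftrightarrow> inj_on (col A) {..<dim_col A}" if "zero_one_mat A"
    unfolding inj_on_def by (intro ball_cong refl) (simp add: eq[OF that])
  then show ?thesis
    by (auto simp: simple_mat_def cols_def distinct_map atLeast0LessThan)
qed

lemma Q8_free_supp:
  assumes "zero_one_mat A" "\<not> Q8 \<prec> A"
  shows "Q8_free (supp A ` {..<dim_col A})"
  unfolding Q8_free_def
proof
  assume "\<exists>a b c. \<exists>S\<in>supp A ` {..<dim_col A}. \<exists>T\<in>supp A ` {..<dim_col A}.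
    \<exists>U\<in>supp A ` {..<dim_col A}. \<exists>V\<in>supp A ` {..<dim_col A}. distinct [a, b, c] \<and>
     S \<inter> {a, b, c} = {b} \<and> T \<inter> {a, b, c} = {c} \<and> U \<inter> {a, b, c} = {a, b} \<and> V \<inter> {a, b, c} = {a, c}"
  then obtain a b c s t u v where d: "distinct [a, b, c]"
    and j: "s \<in> {..<dim_col A}" "t \<in> {..<dim_col A}" "u \<in> {..<dim_col A}" "v \<in> {..<dim_col A}"
    and eq: "supp A s \<inter> {a, b, c} = {b}" "supp A t \<inter> {a, b, c} = {c}"
      "supp A u \<inter> {a, b, c} = {a, b}" "supp A v \<inter> {a, b, c} = {a, c}"
    by (elim exE bexE conjE imageE) (rule that, simp_all only: simp_thms)
  define f where "f i = [a, b, c] ! i" for i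
  define g where "g j = [s, t, u, v] ! j" for j
  \<comment> \<open>Each row index occurs in some trace, and supports only contain valid
    rows.\<close>
  have abc: "a < dim_row A" "b < dim_row A" "c < dim_row A"
    using eq unfolding supp_def by blast+
  have entry: "A $$ (i, j) = (if i \<in> supp A j then 1 else 0)" if "i < dim_row A" "j < dim_col A" for i j
    using that zero_one_mat_entry[OF assms(1) that] by (auto simp: supp_def)
  have mem: "a \<notin> supp A s" "b \<in> supp A s" "c \<notin> supp A s"
    "a \<notin> supp A t" "b \<notin> supp A t" "c \<in> supp A t"
    "a \<in> supp A u" "b \<in> supp A u" "c \<notin> supp A u"
    "a \<in> supp A v" "b \<notin> supp A v" "c \<in> supp A v"
    using eq d by auto
  \<comment> \<open>Different traces on the three rows force different columns.\<close>
  then have "distinct [s, t, u, v]" by auto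
  then have "inj_on g {..<4}" unfolding g_def by (intro inj_on_nth) auto
  moreover have "inj_on f {..<3}" unfolding f_def using d by (intro inj_on_nth) auto
  moreover have "f ` {..<3} \<subseteq> {..<dim_row A}" "g ` {..<4} \<subseteq> {..<dim_col A}"
    unfolding image_subset_iff Ball_def lessThan_iff all_less_numeral_3 all_less_numeral_4 f_def g_def
    using abc j by simp_all
  moreover have "\<forall>i<3. \<forall>j<4. A $$ (f i, g j) = Q8 $$ (i, j)"
    unfolding all_less_numeral_3 all_less_numeral_4 Q8_index f_def g_def
    using entry abc j mem by simp
  ultimately have "Q8 \<prec> A" by (intro configurationI[of f _ _ g]) simp_all
  with assms(2) show False by contradiction
qed

text \<open>Injectivity of \<open>supp\<close> turns \<open>l\<close> members containing
  \<open>K\<close> into \<open>l\<close> columns with ones in all rows of \<open>K\<close>.\<close>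

lemma ones_free_supp:
  assumes "inj_on (supp A) {..<dim_col A}" "\<not> ones_mat k l \<prec> A" "l \<ge> 1"
  shows "ones_free k l (supp A ` {..<dim_col A})"
  unfolding ones_free_def
proof (intro allI impI, rule ccontr)
  fix K :: "nat set" assume K: "finite K \<and> card K = k"
  assume "\<not> card {S \<in> supp A ` {..<dim_col A}. K \<subseteq> S} < l"
  moreover have "{S \<in> supp A ` {..<dim_col A}. K \<subseteq> S} = supp A ` {j \<in> {..<dim_col A}. K \<subseteq> supp A j}"
    by blast
  moreover have "inj_on (supp A) {j \<in> {..<dim_col A}. K \<subseteq> supp A j}"
    using assms(1) by (rule inj_on_subset) auto
  ultimately have "l \<le> card {j \<in> {..<dim_col A}. K \<subseteq> supp A j}"
    by (simp add: card_image)
  then obtain J where J: "J \<subseteq> {j \<in> {..<dim_col A}. K \<subseteq> supp A j}" "card J = l" "finite J"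
    by (rule obtain_subset_with_card_n)
  \<comment> \<open>Since \<open>l \<ge> 1\<close> there is a column in \<open>J\<close>, and its
    support confines \<open>K\<close> to the rows of \<open>A\<close>.\<close>
  then have "J \<noteq> {}" using assms(3) by auto
  then have "K \<subseteq> {..<dim_row A}" using J(1) by (auto simp: supp_def)
  moreover obtain f where "bij_betw f {..<k} K"
    using K ex_bij_betw_nat_finite[of K] by (auto simp: atLeast0LessThan)
  moreover obtain g where "bij_betw g {..<l} J"
    using J ex_bij_betw_nat_finite[of J] by (auto simp: atLeast0LessThan)
  ultimately have "inj_on f {..<k}" "f ` {..<k} \<subseteq> {..<dim_row A}" "inj_on g {..<l}"
    "g ` {..<l} \<subseteq> {..<dim_col A}" "\<forall>i<k. \<forall>j<l. A $$ (f i, g j) = 1"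
    using J(1) by (auto simp: bij_betw_def supp_def)
  then have "ones_mat k l \<prec> A" by (intro configurationI[of f _ _ g]) simp_all
  with assms(2) show False by contradiction
qed

lemma dim_col_le:
  assumes "simple_mat A" "\<not> Q8 \<prec> A" "\<not> ones_mat k l \<prec> A" "l \<ge> 1"
  shows "dim_col A \<le> 1 + dim_row A * (k + l)"
proof -
  have inj: "inj_on (supp A) {..<dim_col A}" and "zero_one_mat A"
    using assms(1) by (simp_all add: simple_mat_iff)
  then have "card (supp A ` {..<dim_col A}) \<le> 1 + card {..<dim_row A} * (k + l)"
    using assms(2-4) by (intro Q8_ones_free_card_le Q8_free_supp ones_free_supp) (auto simp: supp_def)
  then show ?thesis by (simp add: card_image[OF inj])
qed

section \<open>Complementation\<close>

definition compl_mat :: "int mat \<Rightarrow> int mat" where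
  "compl_mat A = map_mat (\<lambda>x. 1 - x) A"

lemma dim_compl_mat [simp]: "dim_row (compl_mat A) = dim_row A" "dim_col (compl_mat A) = dim_col A"
  by (simp_all add: compl_mat_def)

lemma compl_mat_index [simp]:
  "i < dim_row A \<Longrightarrow> j < dim_col A \<Longrightarrow> compl_mat A $$ (i, j) = 1 - A $$ (i, j)"
  by (simp add: compl_mat_def)

lemma compl_mat_compl_mat [simp]: "compl_mat (compl_mat A) = A"
  by (rule eq_matI) simp_all

lemma configuration_compl_mat:
  assumes "F \<prec> A"
  shows "compl_mat F \<prec> compl_mat A"
proof -
  from assms obtain f g where fg: "inj_on f {..<dim_row F}" "f ` {..<dim_row F} \<subseteq> {..<dim_row A}"
    "inj_on g {..<dim_col F}" "g ` {..<dim_col F} \<subseteq> {..<dim_col A}"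
    and eq: "\<And>i j. i < dim_row F \<Longrightarrow> j < dim_col F \<Longrightarrow> A $$ (f i, g j) = F $$ (i, j)"
    using configurationE by metis
  have "compl_mat A $$ (f i, g j) = compl_mat F $$ (i, j)" if "i < dim_row F" "j < dim_col F" for i j
    using that fg(2,4) eq[OF that] by (simp add: image_subset_iff)
  then show ?thesis using fg by (intro configurationI[of f _ _ g]) simp_all
qed

lemma configuration_compl_mat_iff: "F \<prec> compl_mat A \<longleftrightarrow> compl_mat F \<prec> A"
  using configuration_compl_mat[of F "compl_mat A"] configuration_compl_mat[of "compl_mat F" A] by auto

lemma compl_ones_mat: "compl_mat (ones_mat k l) = 0\<^sub>m k l"
  by (rule eq_matI) simp_all

lemma compl_zero_mat: "compl_mat (0\<^sub>m k l) = ones_mat k l"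
  by (metis compl_ones_mat compl_mat_compl_mat)

text \<open>Complementing \<open>Q8\<close> reverses the order of its columns, so \<open>j\<close>
  is replaced by \<open>3 - j\<close>.\<close>

lemma compl_Q8_configuration:
  assumes "compl_mat Q8 \<prec> A"
  shows "Q8 \<prec> A"
proof -
  from assms obtain f g where fg: "inj_on f {..<3}" "f ` {..<3} \<subseteq> {..<dim_row A}"
    "inj_on g {..<4}" "g ` {..<4} \<subseteq> {..<dim_col A}"
    and eq: "\<And>i j. i < 3 \<Longrightarrow> j < 4 \<Longrightarrow> A $$ (f i, g j) = compl_mat Q8 $$ (i, j)"
    by (rule configurationE) simp
  have rev: "inj_on (\<lambda>j. 3 - j) {..<4::nat}" "(\<lambda>j. 3 - j) ` {..<4} \<subseteq> {..<4::nat}"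
    by (auto simp: inj_on_def)
  have compl: "\<forall>i<3. \<forall>j<4. compl_mat Q8 $$ (i, 3 - j) = Q8 $$ (i, j)"
    unfolding all_less_numeral_3 all_less_numeral_4 by (simp add: Q8_index Q8_index[unfolded One_nat_def])
  show ?thesis
  proof (rule configurationI[of f _ _ "g \<circ> (\<lambda>j. 3 - j)"])
    show "inj_on (g \<circ> (\<lambda>j. 3 - j)) {..<dim_col Q8}"
      using rev fg(3) by (auto intro: comp_inj_on inj_on_subset)
    show "(g \<circ> (\<lambda>j. 3 - j)) ` {..<dim_col Q8} \<subseteq> {..<dim_col A}"
      using fg(4) by (simp add: image_subset_iff)
    show "A $$ (f i, (g \<circ> (\<lambda>j. 3 - j)) j) = Q8 $$ (i, j)" if "i < dim_row Q8" "j < dim_col Q8" for i j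
      using that eq[of i "3 - j"] compl by simp
  qed (use fg in simp_all)
qed

text \<open>Each support is complemented within the row set, and a second complement recovers it;
  hence supports stay distinct.\<close>

lemma simple_mat_compl_mat:
  assumes "simple_mat A"
  shows "simple_mat (compl_mat A)"
proof -
  have z: "zero_one_mat A" and inj: "inj_on (supp A) {..<dim_col A}"
    using assms by (simp_all add: simple_mat_iff)
  have "zero_one_mat (compl_mat A)"
    using zero_one_mat_entry[OF z] by (fastforce simp: zero_one_mat_def elements_mat_def)
  moreover have "supp (compl_mat A) j = {..<dim_row A} - supp A j" if "j < dim_col A" for j
    using that by (auto simp: supp_def dest: zero_one_mat_entry[OF z _ that])
  then have "inj_on (supp (compl_mat A)) {..<dim_col A}"
    using inj unfolding inj_on_def by (metis (no_types, lifting) double_diff lessThan_iff mem_Collect_eq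
        order_refl subsetI supp_def)
  ultimately show ?thesis by (simp add: simple_mat_iff)
qed

section \<open>Bounds on forb\<close>

lemma forb_ones_eq_forb_zero: "forb m {Q8, ones_mat k l} = forb m {Q8, 0\<^sub>m k l}"
proof -
  let ?D = "\<lambda>F. {dim_col A | A. dim_row A = m \<and> simple_mat A \<and> (\<forall>F\<in>{Q8, F}. \<not> F \<prec> A)}"
  \<comment> \<open>One inclusion for arbitrary \<open>F\<close> suffices: taking each constant
    matrix in turn gives both directions.\<close>
  have sub: "?D F \<subseteq> ?D (compl_mat F)" for F
  proof clarify
    fix A assume A: "m = dim_row A" "simple_mat A" "\<forall>F\<in>{Q8, F}. \<not> F \<prec> A"
    have "\<not> Q8 \<prec> compl_mat A" "\<not> compl_mat F \<prec> compl_mat A"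
      using A(3) compl_Q8_configuration[of A] by (auto simp: configuration_compl_mat_iff)
    then show "\<exists>B. dim_col A = dim_col B \<and> dim_row B = dim_row A \<and> simple_mat B \<and>
        (\<forall>G\<in>{Q8, compl_mat F}. \<not> G \<prec> B)"
      using simple_mat_compl_mat[OF A(2)] by (intro exI[of _ "compl_mat A"]) simp
  qed
  have "?D (ones_mat k l) = ?D (0\<^sub>m k l)"
    using sub[of "ones_mat k l"] sub[of "0\<^sub>m k l"]
    unfolding compl_ones_mat compl_zero_mat by (rule subset_antisym)
  then show ?thesis unfolding forb_def by simp
qed

text \<open>\<open>Max\<close> is meaningful only on a finite set; the linear bound on the number of
  columns supplies this.\<close>

lemma finite_forb:
  assumes "l \<ge> 1"
  shows "finite {dim_col A | A. dim_row A = m \<and> simple_mat A \<and> (\<forall>F\<in>{Q8, ones_mat k l}. \<not> F \<prec> A)}"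
  by (rule finite_subset[of _ "{..1 + m * (k + l)}"]) (use dim_col_le[OF _ _ _ assms] in auto)

lemma forb_le:
  assumes "l \<ge> 1"
  shows "forb m {Q8, ones_mat k l} \<le> 1 + m * (k + l)"
  unfolding forb_def
proof (rule Max.boundedI[OF finite_forb[OF assms]])
  \<comment> \<open>Nonemptiness for \<open>Max\<close>: the matrix without columns avoids
    \<open>Q8\<close> and, since \<open>l \<ge> 1\<close>, also \<open>ones_mat k l\<close>.\<close>
  have "\<not> F \<prec> 0\<^sub>m m 0" if "F \<in> {Q8, ones_mat k l}" for F
    using that assms by (auto elim!: configurationE simp: lessThan_empty_iff)
  moreover have "simple_mat (0\<^sub>m m 0)" by (simp add: simple_mat_iff zero_one_mat_def elements_mat_def)
  ultimately have "dim_col (0\<^sub>m m 0 :: int mat) \<in> {dim_col A | A. dim_row A = m \<and> simple_mat A \<and> (\<forall>F\<in>{Q8, ones_mat k l}. \<not> F \<prec> A)}"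
    by (intro CollectI exI[of _ "0\<^sub>m m 0"]) simp
  then show "{dim_col A | A. dim_row A = m \<and> simple_mat A \<and> (\<forall>F\<in>{Q8, ones_mat k l}. \<not> F \<prec> A)} \<noteq> {}"
    by blast
qed (use dim_col_le[OF _ _ _ assms] in auto)

text \<open>The identity matrix has ones only where row and column index agree, so two ones of
  \<open>F\<close> in a common row or column would force \<open>f\<close> or \<open>g\<close> to
  repeat a value.\<close>

lemma not_configuration_one_mat:
  assumes F: "i < dim_row F" "i' < dim_row F" "j < dim_col F" "j' < dim_col F"
    and ne: "(i, j) \<noteq> (i', j')" "i = i' \<or> j = j'"
    and one: "F $$ (i, j) = 1" "F $$ (i', j') = 1"
  shows "\<not> F \<prec> 1\<^sub>m m"
proof
  assume "F \<prec> 1\<^sub>m m"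
  then obtain f g where inj: "inj_on f {..<dim_row F}" "inj_on g {..<dim_col F}"
    and im: "f ` {..<dim_row F} \<subseteq> {..<m}" "g ` {..<dim_col F} \<subseteq> {..<m}"
    and eq: "\<And>i j. i < dim_row F \<Longrightarrow> j < dim_col F \<Longrightarrow> 1\<^sub>m m $$ (f i, g j) = F $$ (i, j)"
    by (auto elim: configurationE)
  have diag: "f i = g j" if "i < dim_row F" "j < dim_col F" "F $$ (i, j) = 1" for i j
    using eq[OF that(1,2)] that im by (force simp: image_subset_iff split: if_splits)
  show False
    using diag[OF F(1,3) one(1)] diag[OF F(2,4) one(2)] ne F inj_onD[OF inj(1), of i i'] inj_onD[OF inj(2), of j j'] by auto
qed

lemma forb_ge:
  assumes "k \<ge> 1" "l \<ge> 1" "(k, l) \<noteq> (1, 1)"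
  shows "m \<le> forb m {Q8, ones_mat k l}"
proof -
  \<comment> \<open>The top row of \<open>Q8\<close> has ones in columns 2 and 3, counted from
    0.\<close>
  have "\<not> Q8 \<prec> 1\<^sub>m m"
    by (rule not_configuration_one_mat[of 0 _ 0 2 3]) (simp_all add: Q8_index)
  moreover have "\<not> ones_mat k l \<prec> 1\<^sub>m m"
  \<comment> \<open>If \<open>k = 1\<close> then \<open>l \<ge> 2\<close> gives two ones in a row;
    otherwise \<open>k \<ge> 2\<close> gives two in a column.\<close>
  proof (cases "k = 1")
    case True
    then show ?thesis using assms by (intro not_configuration_one_mat[of 0 _ 0 0 1]) auto
  next
    case False
    then show ?thesis using assms by (intro not_configuration_one_mat[of 0 _ 1 0 0]) auto
  qed
  moreover have "supp (1\<^sub>m m) j = {j}" if "j < m" for j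
    using that by (auto simp: supp_def split: if_splits)
  then have "inj_on (supp (1\<^sub>m m)) {..<m}" by (simp add: inj_on_def)
  then have "simple_mat (1\<^sub>m m)"
    unfolding simple_mat_iff zero_one_mat_def by (fastforce split: if_splits)
  ultimately have "m \<in> {dim_col A | A. dim_row A = m \<and> simple_mat A \<and> (\<forall>F\<in>{Q8, ones_mat k l}. \<not> F \<prec> A)}"
    by (intro CollectI exI[of _ "1\<^sub>m m"]) simp
  then show ?thesis unfolding forb_def by (rule Max_ge[OF finite_forb[OF assms(2)]])
qed

text \<open>The linear lower bound excludes \<open>k = l = 1\<close>: there an admissible matrix is
  zero and, being simple, has at most one column, so \<open>forb\<close> stays bounded.\<close>

theorem proposition3p1:
  fixes k l :: nat
  assumes "k \<ge> 1" and "l \<ge> 1"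
  shows "(\<forall>m. forb m {Q8, ones_mat k l} = forb m {Q8, 0\<^sub>m k l}) \<and>
         (\<lambda>m. real (forb m {Q8, ones_mat k l})) \<in> O(\<lambda>m. real m) \<and>
         ((k, l) \<noteq> (1, 1) \<longrightarrow> (\<lambda>m. real (forb m {Q8, ones_mat k l})) \<in> \<Theta>(\<lambda>m. real m))"
proof -
  \<comment> \<open>The constant absorbs the summand 1 once \<open>m \<ge> 1\<close>; at
    \<open>m = 0\<close> the inequality fails, as a single column without rows is
    admissible.\<close>
  have "real (forb m {Q8, ones_mat k l}) \<le> real (1 + k + l) * real m" if "m \<ge> 1" for m
  proof -
    have "1 + m * (k + l) \<le> (1 + k + l) * m" using that by (simp add: algebra_simps)
    then show ?thesis using forb_le[OF assms(2), of m k] by (metis le_trans of_nat_le_iff of_nat_mult)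
  qed
  then have upper: "(\<lambda>m. real (forb m {Q8, ones_mat k l})) \<in> O(\<lambda>m. real m)"
    by (intro bigoI[of _ "real (1 + k + l)"] eventually_at_top_linorderI[of 1]) auto
  have "(\<lambda>m. real (forb m {Q8, ones_mat k l})) \<in> \<Omega>(\<lambda>m. real m)" if "(k, l) \<noteq> (1, 1)"
    using forb_ge[OF assms that] by (intro landau_omega.bigI[of 1]) auto
  with upper show ?thesis
    using forb_ones_eq_forb_zero by (auto intro: bigthetaI)
qed

end
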